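(* Let $\mu>1$ and assume that $a\in C^1((0,1])$ (with $a(1)=0$). Put $T_c:=\arcsin(\mu^{-1})$. Then the functions $$v(t,x)=1-\mu\sin t,\qquad u(t,x)=-\mu\cos t\,x,\qquad \theta(t,x)=\exp\!\left(-\frac{\alpha\mu}{C_v}\sin t\right),\qquad q(t,x)=0,$$ together with $$F(t,x)=\frac{\phi_x}{v}=\mu\sin t\,x,$$ for example with $\phi(t,x)=\tfrac12(1-\mu\sin t)\,\mu\sin t\,x^2$ (up to an additive function of $t$), solve the Euler--Poisson--Cattaneo system given in the context classically for $0\le t<T_c$, $x\in\mathbb R$. Moreover, $$v(t,x)\downarrow 0,\qquad \rho(t,x)=v(t,x)^{-1}\uparrow+\infty\qquad\text{as } t\uparrow T_c,$$ whereas, for each fixed $x$, the variables $u,\theta,q,F$ remain finite up to $T_c$.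
   Context: Euler--Poisson--Cattaneo (CEP) system in Lagrangian coordinates, unknowns $(v,u,\theta,q,\phi)(t,x)$, $x\in\mathbb R$: $$v_t-u_x=0,\qquad u_t+p_x=\frac{\phi_x}{v},\qquad e_t+pu_x+q_x=0,\qquad \tau q_t+q+\frac{\kappa\theta_x}{v}=0,\qquad \left(\frac{\phi_x}{v}\right)_x=1-v,$$ with $$p=a(v)+\alpha(1-\theta)-\frac{\tau q^2}{2\kappa\theta},\qquad e=C_v\theta+P(v)-\alpha(v-1)+\frac{\tau v q^2}{\kappa\theta},\qquad P(v)=-\int_1^v a(\xi)\,d\xi,\qquad \kappa=\kappa_0 v.$$ Here $C_v,\alpha,\tau,\kappa_0>0$ are constants and $a$ is a given function of $v$ with $a(1)=0$. The Eulerian density is $\rho=1/v$, and $F:=\phi_x/v$. *)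

theory Defs
  imports "HOL-Analysis.Analysis"
begin

text \<open>Functions of time and space are curried, \<open>f t x\<close>. The time derivative is taken relative to
  the time interval \<open>I\<close>, so that it is one-sided at an end point belonging to \<open>I\<close>.\<close>

definition partial_t :: "real set \<Rightarrow> (real \<Rightarrow> real \<Rightarrow> real) \<Rightarrow> real \<Rightarrow> real \<Rightarrow> real" where
  "partial_t I f t x = vector_derivative (\<lambda>s. f s x) (at t within I)"

definition partial_x :: "(real \<Rightarrow> real \<Rightarrow> real) \<Rightarrow> real \<Rightarrow> real \<Rightarrow> real" where
  "partial_x f t x = deriv (f t) x"

definition C1_time_space :: "real set \<Rightarrow> (real \<Rightarrow> real \<Rightarrow> real) \<Rightarrow> bool" where
  "C1_time_space I f \<longleftrightarrow>
     (\<forall>t\<in>I. \<forall>x. (\<lambda>s. f s x) differentiable (at t within I) \<and> f t differentiable (at x)) \<and>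
     continuous_on (I \<times> UNIV) (\<lambda>(t, x). partial_t I f t x) \<and>
     continuous_on (I \<times> UNIV) (\<lambda>(t, x). partial_x f t x)"

text \<open>Unlike \<open>C1_differentiable_on\<close>, the derivative is relative to \<open>J\<close>: nothing is required of
  the values of \<open>f\<close> outside \<open>J\<close>.\<close>

definition C1_within :: "real set \<Rightarrow> (real \<Rightarrow> real) \<Rightarrow> bool" where
  "C1_within J f \<longleftrightarrow>
     f differentiable_on J \<and> continuous_on J (\<lambda>x. vector_derivative f (at x within J))"

definition kappa :: "real \<Rightarrow> real \<Rightarrow> real" where
  "kappa \<kappa>0 v = \<kappa>0 * v"

definition pressure ::
  "(real \<Rightarrow> real) \<Rightarrow> real \<Rightarrow> real \<Rightarrow> real \<Rightarrow> real \<Rightarrow> real \<Rightarrow> real \<Rightarrow> real" where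
  "pressure a \<alpha> \<tau> \<kappa>0 v \<theta> q = a v + \<alpha> * (1 - \<theta>) - \<tau> * q\<^sup>2 / (2 * kappa \<kappa>0 v * \<theta>)"

text \<open>The interval integral is oriented: for \<open>v < 1\<close> it is minus the integral over \<open>[v, 1]\<close>.\<close>

definition potential :: "(real \<Rightarrow> real) \<Rightarrow> real \<Rightarrow> real" where
  "potential a v = - (LBINT \<xi>=1..v. a \<xi>)"

definition internal_energy ::
  "(real \<Rightarrow> real) \<Rightarrow> real \<Rightarrow> real \<Rightarrow> real \<Rightarrow> real \<Rightarrow> real \<Rightarrow> real \<Rightarrow> real \<Rightarrow> real" where
  "internal_energy a Cv \<alpha> \<tau> \<kappa>0 v \<theta> q =
     Cv * \<theta> + potential a v - \<alpha> * (v - 1) + \<tau> * v * q\<^sup>2 / (kappa \<kappa>0 v * \<theta>)"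

definition electric_field ::
  "(real \<Rightarrow> real \<Rightarrow> real) \<Rightarrow> (real \<Rightarrow> real \<Rightarrow> real) \<Rightarrow> real \<Rightarrow> real \<Rightarrow> real" where
  "electric_field v \<phi> t x = partial_x \<phi> t x / v t x"

text \<open>Classical solutions of the Euler--Poisson--Cattaneo system on \<open>I \<times> \<real>\<close>; \<open>J\<close> is the domain of
  the constitutive function \<open>a\<close>. Every quantity differentiated in the system is required to be
  \<open>C\<^sup>1\<close>, so that no derivative below is a junk value. The system involves only \<open>x\<close>-derivatives of
  \<open>\<phi>\<close>, hence no regularity of \<open>\<phi>\<close> itself in \<open>t\<close> is required.\<close>

definition CEP_classical_solution ::
  "real set \<Rightarrow> (real \<Rightarrow> real) \<Rightarrow> real \<Rightarrow> real \<Rightarrow> real \<Rightarrow> real \<Rightarrow> real set \<Rightarrow>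
   (real \<Rightarrow> real \<Rightarrow> real) \<Rightarrow> (real \<Rightarrow> real \<Rightarrow> real) \<Rightarrow> (real \<Rightarrow> real \<Rightarrow> real) \<Rightarrow>
   (real \<Rightarrow> real \<Rightarrow> real) \<Rightarrow> (real \<Rightarrow> real \<Rightarrow> real) \<Rightarrow> bool" where
  "CEP_classical_solution J a Cv \<alpha> \<tau> \<kappa>0 I v u \<theta> q \<phi> \<longleftrightarrow>
    (let p = (\<lambda>t x. pressure a \<alpha> \<tau> \<kappa>0 (v t x) (\<theta> t x) (q t x));
         e = (\<lambda>t x. internal_energy a Cv \<alpha> \<tau> \<kappa>0 (v t x) (\<theta> t x) (q t x));
         F = electric_field v \<phi>
     in (\<forall>t\<in>I. \<forall>x. v t x \<in> J \<and> v t x > 0 \<and> \<theta> t x > 0) \<and>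
        C1_time_space I v \<and> C1_time_space I u \<and> C1_time_space I \<theta> \<and> C1_time_space I q \<and>
        C1_time_space I p \<and> C1_time_space I e \<and>
        (\<forall>t\<in>I. \<forall>x. \<phi> t differentiable (at x)) \<and>
        C1_time_space I (partial_x \<phi>) \<and> C1_time_space I F \<and>
        (\<forall>t\<in>I. \<forall>x.
           partial_t I v t x - partial_x u t x = 0 \<and>
           partial_t I u t x + partial_x p t x = partial_x \<phi> t x / v t x \<and>
           partial_t I e t x + p t x * partial_x u t x + partial_x q t x = 0 \<and>
           \<tau> * partial_t I q t x + q t x
             + kappa \<kappa>0 (v t x) * partial_x \<theta> t x / v t x = 0 \<and>
           partial_x F t x = 1 - v t x))"

text \<open>Reading of ``\<open>f\<close> remains finite up to time \<open>T\<close>'': bounded on \<open>[0, T)\<close>, with a finite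
  left limit at \<open>T\<close>.\<close>

definition remains_finite_up_to :: "real \<Rightarrow> (real \<Rightarrow> real) \<Rightarrow> bool" where
  "remains_finite_up_to T f \<longleftrightarrow> bounded (f ` {0..<T}) \<and> (\<exists>l. (f \<longlongrightarrow> l) (at_left T))"

end

theory Submission
  imports Defs
begin

text \<open>
  The flow is spatially homogeneous: \<open>v\<close> and \<open>\<theta>\<close> depend on time only, \<open>q\<close> vanishes, and \<open>u\<close> and
  \<open>F\<close> are linear in \<open>x\<close>. Pressure and internal energy are then functions of time alone, so
  \<open>p\<^sub>x = 0\<close> and the heat flux equation is trivial, and the system collapses to ordinary
  differential equations. Writing \<open>v = 1 - m\<close>, \<open>F = m x\<close> and \<open>u = - m' x\<close>, mass conservation and
  the Poisson equation hold identically, while momentum balance becomes the harmonic oscillator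
  \<open>m'' = - m\<close>; the solution is \<open>m = \<mu> sin t\<close>. In the energy balance the barotropic part of the
  pressure cancels, because \<open>P' = - a\<close>, and what is left is the linear equation
  \<open>C\<^sub>v \<theta>' = - \<alpha> m' \<theta>\<close>, which \<open>\<theta> = exp (- \<alpha> m / C\<^sub>v)\<close> solves.

  The amplitude \<open>\<mu> > 1\<close> makes \<open>m\<close> reach \<open>1\<close>, first at \<open>arcsin (1 / \<mu>) < \<pi> / 2\<close>. Before that time
  \<open>m\<close> increases from \<open>0\<close> within \<open>[0, 1)\<close>, so \<open>v\<close> stays in \<open>(0, 1]\<close>, where \<open>a\<close> is regular, and
  decreases to \<open>0\<close>. The remaining unknowns are given by entire functions of time and stay finite.

  The regularity of every quantity in the system follows from \<open>C1_time_space_affine\<close>; the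
  possible blow-up of \<open>a\<close> at \<open>0\<close> is harmless because only times strictly before the vacuum
  collapse enter.\<close>

section \<open>Fields affine in space\<close>

text \<open>Every quantity differentiated in the system, apart from \<open>\<phi>\<close> itself, has this form at the times
  in the interval, so both its regularity and its partial derivatives come from this single lemma.
  Nothing is assumed at other times, since the potential is arbitrary there.\<close>

lemma C1_time_space_affine:
  fixes f :: "real \<Rightarrow> real \<Rightarrow> real"
  assumes nontriv: "\<And>t. t \<in> I \<Longrightarrow> at t within I \<noteq> bot"
    and f: "\<And>t x. t \<in> I \<Longrightarrow> f t x = A t * x + B t"
    and A: "\<And>t. t \<in> I \<Longrightarrow> (A has_real_derivative A' t) (at t within I)"
    and B: "\<And>t. t \<in> I \<Longrightarrow> (B has_real_derivative B' t) (at t within I)"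
    and A': "continuous_on I A'" and B': "continuous_on I B'"
  shows "C1_time_space I f"
    and "\<And>t x. t \<in> I \<Longrightarrow> partial_t I f t x = A' t * x + B' t"
    and "\<And>t x. t \<in> I \<Longrightarrow> partial_x f t x = A t"
proof -
  have dt: "((\<lambda>s. f s x) has_vector_derivative A' t * x + B' t) (at t within I)"
    if t: "t \<in> I" for t x
  proof -
    have "((\<lambda>s. A s * x + B s) has_real_derivative A' t * x + B' t) (at t within I)"
      by (auto intro!: derivative_eq_intros A[OF t] B[OF t])
    then show ?thesis
      unfolding has_real_derivative_iff_has_vector_derivative
      by (rule has_vector_derivative_transform[rotated 2]) (auto simp: f t)
  qed
  have dx: "(f t has_real_derivative A t) (at x)" if t: "t \<in> I" for t x
  proof -
    have "f t = (\<lambda>x. A t * x + B t)"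
      using f t by blast
    then show ?thesis
      by (auto intro!: derivative_eq_intros)
  qed
  show pt: "partial_t I f t x = A' t * x + B' t" if "t \<in> I" for t x
    unfolding partial_t_def by (rule vector_derivative_within[OF nontriv dt]) (use that in auto)
  show px: "partial_x f t x = A t" if "t \<in> I" for t x
    unfolding partial_x_def by (rule DERIV_imp_deriv[OF dx[OF that]])
  have contA: "continuous_on I A"
    using A by (auto intro: DERIV_continuous simp: continuous_on_eq_continuous_within)
  have lift: "continuous_on (I \<times> UNIV) (\<lambda>z::real \<times> real. g (fst z))"
    if "continuous_on I g" for g :: "real \<Rightarrow> real"
    by (rule continuous_on_compose2[OF that]) (auto intro: continuous_intros)
  have "continuous_on (I \<times> UNIV) (\<lambda>(t, x). partial_t I f t x)"
  proof (rule continuous_on_eq)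
    show "continuous_on (I \<times> UNIV) (\<lambda>z. A' (fst z) * snd z + B' (fst z))"
      by (intro continuous_intros lift A' B')
  qed (auto simp: pt)
  moreover have "continuous_on (I \<times> UNIV) (\<lambda>(t, x). partial_x f t x)"
    by (rule continuous_on_eq[OF lift[OF contA]]) (auto simp: px)
  ultimately show "C1_time_space I f"
    using dt dx unfolding C1_time_space_def real_differentiable_def
    by (meson has_real_derivative_iff_has_vector_derivative)
qed

lemma C1_time_space_homogeneous:
  fixes f :: "real \<Rightarrow> real \<Rightarrow> real"
  assumes "\<And>t. t \<in> I \<Longrightarrow> at t within I \<noteq> bot"
    and "\<And>t x. t \<in> I \<Longrightarrow> f t x = g t"
    and "\<And>t. t \<in> I \<Longrightarrow> (g has_real_derivative g' t) (at t within I)"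
    and "continuous_on I g'"
  shows "C1_time_space I f"
    and "\<And>t x. t \<in> I \<Longrightarrow> partial_t I f t x = g' t"
    and "\<And>t x. t \<in> I \<Longrightarrow> partial_x f t x = 0"
  using C1_time_space_affine[of I f "\<lambda>_. 0" g "\<lambda>_. 0" g'] assms by auto

lemma C1_time_space_linear:
  fixes f :: "real \<Rightarrow> real \<Rightarrow> real"
  assumes "\<And>t. t \<in> I \<Longrightarrow> at t within I \<noteq> bot"
    and "\<And>t x. t \<in> I \<Longrightarrow> f t x = g t * x"
    and "\<And>t. t \<in> I \<Longrightarrow> (g has_real_derivative g' t) (at t within I)"
    and "continuous_on I g'"
  shows "C1_time_space I f"
    and "\<And>t x. t \<in> I \<Longrightarrow> partial_t I f t x = g' t * x"
    and "\<And>t x. t \<in> I \<Longrightarrow> partial_x f t x = g t"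
  using C1_time_space_affine[of I f g "\<lambda>_. 0" g' "\<lambda>_. 0"] assms by auto

section \<open>Composition with the constitutive function\<close>

lemma C1_within_has_derivative:
  assumes "C1_within J a" and "y \<in> J"
  shows "(a has_real_derivative vector_derivative a (at y within J)) (at y within J)"
  using assms unfolding C1_within_def
  by (auto simp: differentiable_on_def vector_derivative_works
      has_real_derivative_iff_has_vector_derivative)

text \<open>This is the fundamental theorem of calculus on a compact interval \<open>[w, 1]\<close> with \<open>0 < w < y\<close>:
  it contains all points of \<open>(0, 1]\<close> near \<open>y\<close>, and \<open>a\<close> is integrable on it whatever it does at \<open>0\<close>.\<close>

lemma potential_has_derivative:
  assumes "continuous_on {0<..1} a" and "y \<in> {0<..1}"
  shows "(potential a has_real_derivative - a y) (at y within {0<..1})"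
proof -
  define w where "w = y / 2"
  have w: "0 < w" "w < y" "y \<le> 1"
    using assms(2) by (auto simp: w_def)
  have "continuous_on {w..1} a"
    by (rule continuous_on_subset[OF assms(1)]) (use w in auto)
  then have "((\<lambda>u. LBINT \<xi>=1..u. a \<xi>) has_vector_derivative a y) (at y within {w..1})"
    using interval_integral_FTC2[of w 1 1 a y] w by (simp add: one_ereal_def)
  then have "(potential a has_real_derivative - a y) (at y within {w..1})"
    unfolding potential_def has_real_derivative_iff_has_vector_derivative
    by (rule has_vector_derivative_minus)
  moreover have "at y within {0<..1} = at y within {w..1}"
    by (rule at_within_nhd[where S = "{w<..}"]) (use w in auto)
  ultimately show ?thesis
    by simp
qed

lemma has_real_derivative_compose_within:
  fixes g :: "real \<Rightarrow> real"
  assumes "(g has_real_derivative g') (at t within I)" and "g ` I \<subseteq> J"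
    and "(h has_real_derivative h') (at (g t) within J)"
  shows "((\<lambda>s. h (g s)) has_real_derivative h' * g') (at t within I)"
  using DERIV_image_chain[OF DERIV_subset[OF assms(3,2)] assms(1)] by (simp add: o_def)

section \<open>Potentials of a prescribed field\<close>

text \<open>The derivative in \<open>x\<close> determines a potential only up to a constant at each time, and these
  constants need not depend on time in any regular way.\<close>

lemma electric_field_linear_iff:
  fixes v \<phi> :: "real \<Rightarrow> real \<Rightarrow> real"
  assumes v: "\<And>t x. t \<in> I \<Longrightarrow> v t x = V t" and V: "\<And>t. t \<in> I \<Longrightarrow> V t \<noteq> 0"
  shows "(\<forall>t\<in>I. \<forall>x. \<phi> t differentiable (at x) \<and> electric_field v \<phi> t x = m t * x) \<longleftrightarrow>
         (\<exists>c. \<forall>t\<in>I. \<forall>x. \<phi> t x = 1 / 2 * V t * m t * x\<^sup>2 + c t)"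
proof
  assume L: "\<forall>t\<in>I. \<forall>x. \<phi> t differentiable (at x) \<and> electric_field v \<phi> t x = m t * x"
  have "\<phi> t x = 1 / 2 * V t * m t * x\<^sup>2 + \<phi> t 0" if t: "t \<in> I" for t x
  proof -
    have \<phi>: "(\<phi> t has_real_derivative V t * m t * y) (at y)" for y
    proof -
      have "deriv (\<phi> t) y = V t * m t * y"
        using L t V[OF t] by (force simp: electric_field_def partial_x_def v[OF t] field_simps)
      with L t show ?thesis
        by (metis DERIV_deriv_iff_real_differentiable)
    qed
    have "((\<lambda>y. \<phi> t y - 1 / 2 * V t * m t * y\<^sup>2) has_real_derivative 0) (at y)" for y
      by (rule derivative_eq_intros \<phi> refl)+ simp
    from DERIV_isconst_all[OF allI, OF this, of x 0] show ?thesis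
      by simp
  qed
  then show "\<exists>c. \<forall>t\<in>I. \<forall>x. \<phi> t x = 1 / 2 * V t * m t * x\<^sup>2 + c t"
    by (intro exI[of _ "\<lambda>t. \<phi> t 0"]) blast
next
  assume "\<exists>c. \<forall>t\<in>I. \<forall>x. \<phi> t x = 1 / 2 * V t * m t * x\<^sup>2 + c t"
  then obtain c where c: "\<And>t x. t \<in> I \<Longrightarrow> \<phi> t x = 1 / 2 * V t * m t * x\<^sup>2 + c t"
    by blast
  show "\<forall>t\<in>I. \<forall>x. \<phi> t differentiable (at x) \<and> electric_field v \<phi> t x = m t * x"
  proof (intro ballI allI)
    fix t x assume t: "t \<in> I"
    have "\<phi> t = (\<lambda>x. 1 / 2 * V t * m t * x\<^sup>2 + c t)"
      using c t by blast
    then have d: "(\<phi> t has_real_derivative V t * m t * x) (at x)"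
      by (auto intro!: derivative_eq_intros)
    then have "electric_field v \<phi> t x = m t * x"
      using V[OF t] by (simp add: electric_field_def partial_x_def v[OF t] DERIV_imp_deriv)
    with d show "\<phi> t differentiable (at x) \<and> electric_field v \<phi> t x = m t * x"
      unfolding real_differentiable_def by blast
  qed
qed

section \<open>The homogeneous solution\<close>

text \<open>The amplitude and the time interval enter only through the requirement that the specific
  volume stays in \<open>(0, 1]\<close>, the domain of \<open>a\<close>.\<close>

lemma CEP_homogeneous_solution:
  fixes a :: "real \<Rightarrow> real"
  assumes "Cv > 0" and a: "C1_within {0<..1} a"
    and nontriv: "\<And>t. t \<in> I \<Longrightarrow> at t within I \<noteq> bot"
    and range: "\<And>t. t \<in> I \<Longrightarrow> 1 - \<mu> * sin t \<in> {0<..1}"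
    and v: "v = (\<lambda>t x. 1 - \<mu> * sin t)"
    and u: "u = (\<lambda>t x. - \<mu> * cos t * x)"
    and \<theta>: "\<theta> = (\<lambda>t x. exp (- (\<alpha> * \<mu> / Cv) * sin t))"
    and q: "q = (\<lambda>t x. 0)"
    and \<phi>: "\<And>t x. t \<in> I \<Longrightarrow> \<phi> t differentiable (at x)"
    and F: "\<And>t x. t \<in> I \<Longrightarrow> electric_field v \<phi> t x = \<mu> * sin t * x"
  shows "CEP_classical_solution {0<..1} a Cv \<alpha> \<tau> \<kappa>0 I v u \<theta> q \<phi>"
proof -
  define V where "V = (\<lambda>t. 1 - \<mu> * sin t)"
  define \<Theta> where "\<Theta> = (\<lambda>t. exp (- (\<alpha> * \<mu> / Cv) * sin t))"
  define \<Theta>' where "\<Theta>' = (\<lambda>t. \<Theta> t * (- (\<alpha> * \<mu> / Cv) * cos t))"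
  define da where "da = (\<lambda>y. vector_derivative a (at y within {0<..1}))"
  define p where "p = (\<lambda>t x. pressure a \<alpha> \<tau> \<kappa>0 (v t x) (\<theta> t x) (q t x))"
  define e where "e = (\<lambda>t x. internal_energy a Cv \<alpha> \<tau> \<kappa>0 (v t x) (\<theta> t x) (q t x))"
  have VI: "V ` I \<subseteq> {0<..1}"
    using range by (auto simp: V_def)
  have V: "(V has_real_derivative - \<mu> * cos t) (at t within I)" for t
    unfolding V_def by (auto intro!: derivative_eq_intros)
  have \<Theta>: "(\<Theta> has_real_derivative \<Theta>' t) (at t within I)" for t
    using \<open>Cv > 0\<close> unfolding \<Theta>_def \<Theta>'_def by (auto intro!: derivative_eq_intros)
  have aV: "((\<lambda>s. a (V s)) has_real_derivative da (V t) * (- \<mu> * cos t)) (at t within I)"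
    if "t \<in> I" for t
    unfolding da_def
    by (rule has_real_derivative_compose_within[OF V VI C1_within_has_derivative[OF a]])
       (use VI that in auto)
  have a_cont: "continuous_on {0<..1} a"
    using a differentiable_imp_continuous_on unfolding C1_within_def by blast
  have PV: "((\<lambda>s. potential a (V s)) has_real_derivative - a (V t) * (- \<mu> * cos t)) (at t within I)"
    if "t \<in> I" for t
    by (rule has_real_derivative_compose_within[OF V VI potential_has_derivative[OF a_cont]])
       (use VI that in auto)
  have cV: "continuous_on I V"
    unfolding V_def by (intro continuous_intros)
  have c\<Theta>': "continuous_on I \<Theta>'"
    unfolding \<Theta>'_def \<Theta>_def by (intro continuous_intros)
  have caV: "continuous_on I (\<lambda>t. a (V t))"
    by (rule continuous_on_compose2[OF a_cont cV VI])
  have cdaV: "continuous_on I (\<lambda>t. da (V t))"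
    by (rule continuous_on_compose2[OF _ cV VI]) (use a in \<open>auto simp: C1_within_def da_def\<close>)

  note v_C1 = C1_time_space_homogeneous[of I v V "\<lambda>t. - \<mu> * cos t", OF nontriv _ V]
  have v_C1: "C1_time_space I v" "\<And>t x. t \<in> I \<Longrightarrow> partial_t I v t x = - \<mu> * cos t"
    by (rule v_C1; force simp: v V_def intro!: continuous_intros)+
  have "((\<lambda>t. - \<mu> * cos t) has_real_derivative \<mu> * sin t) (at t within I)" for t
    by (auto intro!: derivative_eq_intros)
  note u_C1 = C1_time_space_linear[of I u "\<lambda>t. - \<mu> * cos t" "\<lambda>t. \<mu> * sin t", OF nontriv _ this]
  have u_C1: "C1_time_space I u" "\<And>t x. t \<in> I \<Longrightarrow> partial_t I u t x = \<mu> * sin t * x"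
    "\<And>t x. t \<in> I \<Longrightarrow> partial_x u t x = - \<mu> * cos t"
    by (rule u_C1; force simp: u intro!: continuous_intros)+
  note \<theta>_C1 = C1_time_space_homogeneous[of I \<theta> \<Theta> \<Theta>', OF nontriv _ \<Theta> c\<Theta>']
  have \<theta>_C1: "C1_time_space I \<theta>" "\<And>t x. t \<in> I \<Longrightarrow> partial_x \<theta> t x = 0"
    by (rule \<theta>_C1; force simp: \<theta> \<Theta>_def)+
  note q_C1 = C1_time_space_homogeneous[of I q "\<lambda>_. 0" "\<lambda>_. 0", OF nontriv]
  have q_C1: "C1_time_space I q" "\<And>t x. t \<in> I \<Longrightarrow> partial_t I q t x = 0"
    "\<And>t x. t \<in> I \<Longrightarrow> partial_x q t x = 0"
    by (rule q_C1; force simp: q)+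

  have p_eq: "p t x = a (V t) + \<alpha> * (1 - \<Theta> t)" for t x
    by (simp add: p_def pressure_def q v \<theta> V_def \<Theta>_def)
  have "((\<lambda>t. a (V t) + \<alpha> * (1 - \<Theta> t)) has_real_derivative
      da (V t) * (- \<mu> * cos t) - \<alpha> * \<Theta>' t) (at t within I)" if "t \<in> I" for t
    by (auto intro!: derivative_eq_intros aV[OF that] \<Theta>)
  note p_C1 = C1_time_space_homogeneous[of I p, OF nontriv p_eq this]
  have p_C1: "C1_time_space I p" "\<And>t x. t \<in> I \<Longrightarrow> partial_x p t x = 0"
    by (rule p_C1; force intro!: continuous_intros cdaV c\<Theta>')+

  have e_eq: "e t x = Cv * \<Theta> t + potential a (V t) - \<alpha> * (V t - 1)" for t x
    by (simp add: e_def internal_energy_def q v \<theta> V_def \<Theta>_def)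
  have "((\<lambda>t. Cv * \<Theta> t + potential a (V t) - \<alpha> * (V t - 1)) has_real_derivative
      Cv * \<Theta>' t + - a (V t) * (- \<mu> * cos t) - \<alpha> * (- \<mu> * cos t)) (at t within I)"
    if "t \<in> I" for t
    by (auto intro!: derivative_eq_intros PV[OF that] \<Theta> V)
  note e_C1 = C1_time_space_homogeneous[of I e, OF nontriv e_eq this]
  have e_C1: "C1_time_space I e"
    "\<And>t x. t \<in> I \<Longrightarrow>
      partial_t I e t x = Cv * \<Theta>' t + - a (V t) * (- \<mu> * cos t) - \<alpha> * (- \<mu> * cos t)"
    by (rule e_C1; force intro!: continuous_intros caV c\<Theta>')+

  have m: "((\<lambda>t. \<mu> * sin t) has_real_derivative \<mu> * cos t) (at t within I)" for t
    by (auto intro!: derivative_eq_intros)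
  note F_C1 = C1_time_space_linear[of I "electric_field v \<phi>", OF nontriv F m]
  have F_C1: "C1_time_space I (electric_field v \<phi>)"
    "\<And>t x. t \<in> I \<Longrightarrow> partial_x (electric_field v \<phi>) t x = \<mu> * sin t"
    by (rule F_C1; force intro!: continuous_intros)+
  have \<phi>x_eq: "partial_x \<phi> t x = V t * (\<mu> * sin t) * x" if "t \<in> I" for t x
    using F[OF that, of x] range[OF that] by (simp add: electric_field_def v V_def field_simps)
  have "((\<lambda>t. V t * (\<mu> * sin t)) has_real_derivative
      - \<mu> * cos t * (\<mu> * sin t) + V t * (\<mu> * cos t)) (at t within I)" for t
    by (auto intro!: derivative_eq_intros V)
  note \<phi>x_C1 = C1_time_space_linear(1)[of I "partial_x \<phi>", OF nontriv \<phi>x_eq this]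
  have \<phi>x_C1: "C1_time_space I (partial_x \<phi>)"
    by (rule \<phi>x_C1; force intro!: continuous_intros cV)

  \<comment> \<open>The terms with \<open>a (V t)\<close> cancel, and so do those with \<open>\<alpha>\<close> alone; the remaining
    \<open>Cv * \<Theta>' t + \<alpha> * \<Theta> t * \<mu> * cos t\<close> vanishes by the choice of the exponent of \<open>\<Theta>\<close>.\<close>
  have energy: "partial_t I e t x + p t x * partial_x u t x + partial_x q t x = 0"
    if "t \<in> I" for t x
    using that \<open>Cv > 0\<close> by (simp add: e_C1 p_eq u_C1 q_C1 \<Theta>'_def field_simps)
  have "\<forall>t\<in>I. \<forall>x. v t x \<in> {0<..1} \<and> v t x > 0 \<and> \<theta> t x > 0"
    using range by (auto simp: v \<theta>)
  moreover have "partial_t I u t x + partial_x p t x = partial_x \<phi> t x / v t x"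
    if "t \<in> I" for t x
    using F[OF that, of x] that by (simp add: u_C1 p_C1 electric_field_def)
  moreover have "\<tau> * partial_t I q t x + q t x + kappa \<kappa>0 (v t x) * partial_x \<theta> t x / v t x = 0"
    if "t \<in> I" for t x
    using that by (simp add: q_C1 \<theta>_C1) (simp add: q)
  moreover have "partial_x (electric_field v \<phi>) t x = 1 - v t x" if "t \<in> I" for t x
    using F_C1(2)[OF that] by (simp add: v)
  ultimately show ?thesis
    unfolding CEP_classical_solution_def Let_def p_def[symmetric] e_def[symmetric]
    using v_C1 u_C1 \<theta>_C1(1) q_C1(1) p_C1(1) e_C1(1) F_C1(1) \<phi>x_C1 \<phi> energy by auto
qed

section \<open>Behaviour up to the collapse time\<close>

lemma remains_finite_up_to_if_continuous:
  assumes "0 < T" and "continuous_on {0..T} f"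
  shows "remains_finite_up_to T f"
proof -
  have "bounded (f ` {0..T})"
    by (intro compact_imp_bounded compact_continuous_image assms compact_Icc)
  then have "bounded (f ` {0..<T})"
    by (rule bounded_subset) auto
  moreover have "(f \<longlongrightarrow> f T) (at_left T)"
    by (rule continuous_on_Icc_at_leftD[OF assms(2,1)])
  ultimately show ?thesis
    unfolding remains_finite_up_to_def by blast
qed

lemma collapse_time:
  assumes "\<mu> > 1"
  shows "0 < arcsin (inverse \<mu>)" "arcsin (inverse \<mu>) < pi / 2"
    "\<mu> * sin (arcsin (inverse \<mu>)) = 1"
proof -
  have \<mu>: "0 < inverse \<mu>" "inverse \<mu> < 1"
    using assms by (auto simp: field_simps)
  show "0 < arcsin (inverse \<mu>)"
    using \<mu> arcsin_less_mono[of 0 "inverse \<mu>"] by simp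
  show "arcsin (inverse \<mu>) < pi / 2"
    using \<mu> arcsin_lt_bounded[of "inverse \<mu>"] by linarith
  show "\<mu> * sin (arcsin (inverse \<mu>)) = 1"
    using \<mu> assms by (subst sin_arcsin) (linarith | simp)+
qed

section \<open>Collapse to infinite density in finite time\<close>

theorem theorem1p1:
  fixes a :: "real \<Rightarrow> real" and Cv \<alpha> \<tau> \<kappa>0 \<mu> Tc :: real
    and v \<rho> u \<theta> q F :: "real \<Rightarrow> real \<Rightarrow> real"
  assumes "Cv > 0" "\<alpha> > 0" "\<tau> > 0" "\<kappa>0 > 0"
    and "\<mu> > 1"
    and "C1_within {0<..1} a" and "a 1 = 0"
    and "Tc = arcsin (inverse \<mu>)"
    and "v = (\<lambda>t x. 1 - \<mu> * sin t)"
    and "u = (\<lambda>t x. - \<mu> * cos t * x)"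
    and "\<theta> = (\<lambda>t x. exp (- (\<alpha> * \<mu> / Cv) * sin t))"
    and "q = (\<lambda>t x. 0)"
    and "F = (\<lambda>t x. \<mu> * sin t * x)"
    and "\<rho> = (\<lambda>t x. inverse (v t x))"
  shows
    "(\<forall>\<phi>. (\<forall>t\<in>{0..<Tc}. \<forall>x. \<phi> t differentiable (at x) \<and> electric_field v \<phi> t x = F t x) \<longrightarrow>
        CEP_classical_solution {0<..1} a Cv \<alpha> \<tau> \<kappa>0 {0..<Tc} v u \<theta> q \<phi>) \<and>
     (\<forall>\<phi>. (\<forall>t\<in>{0..<Tc}. \<forall>x. \<phi> t differentiable (at x) \<and> electric_field v \<phi> t x = F t x) \<longleftrightarrow>
        (\<exists>c. \<forall>t\<in>{0..<Tc}. \<forall>x. \<phi> t x = 1 / 2 * (1 - \<mu> * sin t) * (\<mu> * sin t) * x\<^sup>2 + c t)) \<and>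
     (\<forall>x. antimono_on {0..<Tc} (\<lambda>t. v t x) \<and> ((\<lambda>t. v t x) \<longlongrightarrow> 0) (at_left Tc) \<and>
          mono_on {0..<Tc} (\<lambda>t. \<rho> t x) \<and> filterlim (\<lambda>t. \<rho> t x) at_top (at_left Tc)) \<and>
     (\<forall>x. remains_finite_up_to Tc (\<lambda>t. u t x) \<and> remains_finite_up_to Tc (\<lambda>t. \<theta> t x) \<and>
          remains_finite_up_to Tc (\<lambda>t. q t x) \<and> remains_finite_up_to Tc (\<lambda>t. F t x))"
proof -
  note v = \<open>v = _\<close> and \<rho> = \<open>\<rho> = _\<close>
  let ?I = "{0..<Tc}"
  note Tc = collapse_time[OF \<open>\<mu> > 1\<close>, folded \<open>Tc = _\<close>]
  have incr: "\<mu> * sin s \<le> \<mu> * sin t" if "0 \<le> s" "s \<le> t" "t \<le> Tc" for s t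
    using that Tc \<open>\<mu> > 1\<close> by (intro mult_left_mono sin_monotone_2pi_le) auto
  have lt1: "\<mu> * sin t < 1" if "t \<in> ?I" for t
  proof -
    have "sin t < sin Tc"
      using that Tc by (intro sin_monotone_2pi) auto
    then have "\<mu> * sin t < \<mu> * sin Tc"
      using \<open>\<mu> > 1\<close> by simp
    then show ?thesis
      using Tc by simp
  qed
  have range: "1 - \<mu> * sin t \<in> {0<..1}" if "t \<in> ?I" for t
    using incr[of 0 t] lt1[OF that] that by auto
  have nontriv: "at t within ?I \<noteq> bot" if "t \<in> ?I" for t
    using that by (simp add: trivial_limit_within islimpt_Ico)
  have field: "(\<forall>t\<in>?I. \<forall>x. \<phi> t differentiable (at x) \<and> electric_field v \<phi> t x = F t x) \<longleftrightarrow>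
      (\<exists>c. \<forall>t\<in>?I. \<forall>x. \<phi> t x = 1 / 2 * (1 - \<mu> * sin t) * (\<mu> * sin t) * x\<^sup>2 + c t)" for \<phi>
    unfolding \<open>F = _\<close>
    by (rule electric_field_linear_iff) (use lt1 in \<open>force simp: v\<close>)+
  have solution: "CEP_classical_solution {0<..1} a Cv \<alpha> \<tau> \<kappa>0 ?I v u \<theta> q \<phi>"
    if "\<forall>t\<in>?I. \<forall>x. \<phi> t differentiable (at x) \<and> electric_field v \<phi> t x = F t x" for \<phi>
    by (rule CEP_homogeneous_solution[OF \<open>Cv > 0\<close> \<open>C1_within _ a\<close> nontriv range v
          \<open>u = _\<close> \<open>\<theta> = _\<close> \<open>q = _\<close>])
       (use that in \<open>auto simp: \<open>F = _\<close>\<close>)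
  have v_lim: "((\<lambda>t. v t x) \<longlongrightarrow> 0) (at_left Tc)" for x
  proof -
    have "((\<lambda>t. 1 - \<mu> * sin t) \<longlongrightarrow> 1 - \<mu> * sin Tc) (at_left Tc)"
      by (intro tendsto_intros)
    then show ?thesis
      using Tc by (simp add: v)
  qed
  have "\<forall>\<^sub>F t in at_left Tc. t \<in> {0<..<Tc}"
    using Tc by (intro eventually_at_left_real)
  then have v_pos: "\<forall>\<^sub>F t in at_left Tc. 0 < v t x" for x
    by eventually_elim (use lt1 in \<open>auto simp: v\<close>)
  have \<rho>_lim: "filterlim (\<lambda>t. \<rho> t x) at_top (at_left Tc)" for x
    unfolding \<rho> by (rule filterlim_inverse_at_top[OF v_lim v_pos])
  have v_mono: "antimono_on ?I (\<lambda>t. v t x)" for x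
    using incr by (auto intro!: monotone_onI simp: v)
  have \<rho>_mono: "mono_on ?I (\<lambda>t. \<rho> t x)" for x
    using incr lt1 by (auto intro!: monotone_onI le_imp_inverse_le simp: \<rho> v)
  have finite: "remains_finite_up_to Tc (\<lambda>t. u t x)" "remains_finite_up_to Tc (\<lambda>t. \<theta> t x)"
    "remains_finite_up_to Tc (\<lambda>t. q t x)" "remains_finite_up_to Tc (\<lambda>t. F t x)" for x
    unfolding \<open>u = _\<close> \<open>\<theta> = _\<close> \<open>q = _\<close> \<open>F = _\<close>
    by (intro remains_finite_up_to_if_continuous Tc continuous_intros)+
  show ?thesis
    using field solution v_lim \<rho>_lim v_mono \<rho>_mono finite by blast
qed

end
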